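(* Let $\Psi:\mathbb{Q}[x]\to\mathbb{Q}$ be the linear form with $\Psi(x^n)=B_n$, where $\frac{t}{e^t-1}=\sum_{n\ge0}B_n\frac{t^n}{n!}$, and let $\mathscr{R}^+_n=\Psi\!\left(\binom{x+2}{2}^n\right)$ for $n\ge0$. Let $(R_n)_{n\ge0}$ be the Racah polynomials with parameters $(\alpha,\beta,\gamma,\delta)=(-1/2,2,1,-1)$, and let $\Lambda$ be the unique linear form on $\mathbb{Q}[y]$ with $\Lambda(1)=1$ and $\Lambda(R_n)=0$ for all $n>0$. Then $\Lambda(y^n)=2^n\mathscr{R}^+_{n+2}/\mathscr{R}^+_2$ for all $n\ge 0$, i.e. the numbers $(2^n\mathscr{R}^+_{n+2}/\mathscr{R}^+_2)_{n\ge0}$ are the moments of this family of orthogonal polynomials.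
   Context: For parameters $\alpha,\beta,\gamma,\delta$, the Racah polynomial $R_n$ is the polynomial of degree $n$ in a variable $y$ such that, with $\lambda(x)=x(x+\gamma+\delta+1)$, $$R_n(\lambda(x))=\sum_{k=0}^{n}\frac{(-n)_k(n+\alpha+\beta+1)_k(-x)_k(x+\gamma+\delta+1)_k}{(\alpha+1)_k(\beta+\delta+1)_k(\gamma+1)_k\,k!},$$ where $(a)_k=a(a+1)\cdots(a+k-1)$ is the Pochhammer symbol. The "moments" of the family are $\Lambda(y^n)$, $n\ge 0$. *)

theory Defs
  imports "HOL-Computational_Algebra.Computational_Algebra"
begin

(* The convention fixed by t/(e^t - 1) has bernoulli 1 = -1/2. *)
definition bernoulli :: "nat \<Rightarrow> rat" where
  "bernoulli n = fact n * fps_nth (fps_X / (fps_exp 1 - 1)) n"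

lemma bernoulli_egf:
  "Abs_fps (\<lambda>n. bernoulli n / fact n) * (fps_exp 1 - 1) = fps_X"
proof -
  have nz: "fps_nth (fps_exp 1 - 1 :: rat fps) 1 \<noteq> 0" by simp
  have sd: "subdegree (fps_exp 1 - 1 :: rat fps) = 1"
    by (rule subdegreeI) auto
  have "Abs_fps (\<lambda>n. bernoulli n / fact n) = fps_X / (fps_exp 1 - 1)"
    by (rule fps_ext) (simp add: bernoulli_def)
  moreover have "(fps_exp 1 - 1 :: rat fps) dvd fps_X"
    using nz sd by (subst fps_dvd_iff) auto
  ultimately show ?thesis by simp
qed

definition linear_form :: "(rat poly \<Rightarrow> rat) \<Rightarrow> bool" where
  "linear_form L \<longleftrightarrow> Vector_Spaces.linear smult (*) L"

lemma linear_form_iff: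
  "linear_form L \<longleftrightarrow> (\<forall>p q. L (p + q) = L p + L q) \<and> (\<forall>c p. L (smult c p) = c * L p)"
proof -
  have "vector_space (smult :: rat \<Rightarrow> rat poly \<Rightarrow> rat poly)"
    by unfold_locales (simp_all add: smult_add_right smult_add_left)
  moreover have "vector_space ((*) :: rat \<Rightarrow> rat \<Rightarrow> rat)"
    by unfold_locales (simp_all add: algebra_simps)
  ultimately show ?thesis
    unfolding linear_form_def Vector_Spaces.linear_iff by blast
qed

lemma linear_form_exists_unique:
  "\<exists>!L. linear_form L \<and> (\<forall>n. L (monom 1 n) = b n)"
proof (rule ex_ex1I)
  define L where "L = (\<lambda>p :: rat poly. \<Sum>i\<le>degree p. coeff p i * b i)"
  have L: "L p = (\<Sum>i\<le>N. coeff p i * b i)" if "degree p \<le> N" for p N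
    unfolding L_def using that
    by (intro sum.mono_neutral_left) (auto simp: coeff_eq_0)
  have "L (p + q) = L p + L q" for p q
  proof -
    define N where "N = max (degree p) (degree q)"
    have "degree (p + q) \<le> N" "degree p \<le> N" "degree q \<le> N"
      unfolding N_def by (auto intro: degree_add_le)
    then show ?thesis by (simp add: L sum.distrib algebra_simps)
  qed
  moreover have "L (smult c p) = c * L p" for c p
    using L[of "smult c p" "degree p"] L[of p "degree p"]
    by (simp add: sum_distrib_left mult.assoc)
  moreover have "L (monom 1 n) = b n" for n
  proof -
    have "L (monom 1 n) = (\<Sum>i\<le>n. if i = n then b i else 0)"
      unfolding L[of "monom 1 n" n, OF degree_monom_le] by (intro sum.cong) auto
    then show ?thesis by simp
  qed
  ultimately show "\<exists>L. linear_form L \<and> (\<forall>n. L (monom 1 n) = b n)"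
    unfolding linear_form_iff by blast
next
  fix L M
  assume L: "linear_form L \<and> (\<forall>n. L (monom 1 n) = b n)"
    and M: "linear_form M \<and> (\<forall>n. M (monom 1 n) = b n)"
  show "L = M"
  proof
    fix p :: "rat poly"
    have p: "p = (\<Sum>i\<le>degree p. smult (coeff p i) (monom 1 i))"
      by (simp add: smult_monom poly_as_sum_of_monoms)
    have sm: "N (sum f A) = (\<Sum>i\<in>A. N (f i))" if "linear_form N" "finite A"
      for N and f :: "nat \<Rightarrow> rat poly" and A
      using that unfolding linear_form_def by (auto intro: Modules.module_hom.sum simp: linear_iff_module_hom)
    have "N p = (\<Sum>i\<le>degree p. coeff p i * b i)"
      if "linear_form N \<and> (\<forall>n. N (monom 1 n) = b n)" for N
    proof -
      have "N p = (\<Sum>i\<le>degree p. N (smult (coeff p i) (monom 1 i)))"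
        using that by (subst p) (simp only: sm finite_atMost)
      also have "\<dots> = (\<Sum>i\<le>degree p. coeff p i * b i)"
        using that unfolding linear_form_iff by (intro sum.cong) auto
      finally show ?thesis .
    qed
    from this[OF L] this[OF M] show "L p = M p" by (rule trans[OF _ sym])
  qed
qed

definition binomial_poly :: "rat poly" where
  "binomial_poly = smult (1 / 2) ([:2, 1:] * [:1, 1:])"

lemma poly_binomial_poly: "poly binomial_poly x = (x + 2) gchoose 2"
  by (simp add: binomial_poly_def gbinomial_prod_rev numeral_2_eq_2 field_simps)

text \<open>
  Agreement for all \<open>x\<close> determines the polynomial, since \<open>x * (x + \<gamma> + \<delta> + 1)\<close> takes infinitely
  many values. If no such polynomial of degree exactly \<open>n\<close> exists (degenerate parameters), the
  value is unspecified; \<open>racah_ex1\<close> gives a sufficient condition for existence.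
\<close>

definition racah :: "'a::field_char_0 \<Rightarrow> 'a \<Rightarrow> 'a \<Rightarrow> 'a \<Rightarrow> nat \<Rightarrow> 'a poly" where
  "racah \<alpha> \<beta> \<gamma> \<delta> n = (THE p. degree p = n \<and>
     (\<forall>x. poly p (x * (x + \<gamma> + \<delta> + 1)) =
       (\<Sum>k\<le>n. pochhammer (- of_nat n) k * pochhammer (of_nat n + \<alpha> + \<beta> + 1) k *
          pochhammer (- x) k * pochhammer (x + \<gamma> + \<delta> + 1) k /
          (pochhammer (\<alpha> + 1) k * pochhammer (\<beta> + \<delta> + 1) k * pochhammer (\<gamma> + 1) k * fact k))))"

lemma racah_ex1:
  fixes \<alpha> \<beta> \<gamma> \<delta> :: "'a::field_char_0"
  assumes "pochhammer (of_nat n + \<alpha> + \<beta> + 1) n \<noteq> 0" "pochhammer (\<alpha> + 1) n \<noteq> 0"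
    "pochhammer (\<beta> + \<delta> + 1) n \<noteq> 0" "pochhammer (\<gamma> + 1) n \<noteq> 0"
  shows "\<exists>!p. degree p = n \<and>
     (\<forall>x. poly p (x * (x + \<gamma> + \<delta> + 1)) =
       (\<Sum>k\<le>n. pochhammer (- of_nat n) k * pochhammer (of_nat n + \<alpha> + \<beta> + 1) k *
          pochhammer (- x) k * pochhammer (x + \<gamma> + \<delta> + 1) k /
          (pochhammer (\<alpha> + 1) k * pochhammer (\<beta> + \<delta> + 1) k * pochhammer (\<gamma> + 1) k * fact k)))"
    (is "\<exists>!p. degree p = n \<and> (\<forall>x. poly p (x * (x + \<gamma> + \<delta> + 1)) = ?S x)")
proof (rule ex_ex1I)
  define c where "c k = pochhammer (- of_nat n) k * pochhammer (of_nat n + \<alpha> + \<beta> + 1) k /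
    (pochhammer (\<alpha> + 1) k * pochhammer (\<beta> + \<delta> + 1) k * pochhammer (\<gamma> + 1) k * fact k)" for k
  define q :: "nat \<Rightarrow> 'a poly" where
    "q k = (\<Prod>j<k. [:of_nat j * (of_nat j + \<gamma> + \<delta> + 1), - 1:])" for k
  define p where "p = (\<Sum>k\<le>n. smult (c k) (q k))"
  have deg_q: "degree (q k) = k" for k
    unfolding q_def by (subst degree_prod_eq_sum_degree) auto
  have "poly (q k) (x * (x + \<gamma> + \<delta> + 1)) = pochhammer (- x) k * pochhammer (x + \<gamma> + \<delta> + 1) k"
    for k x
  proof (induction k)
    case 0
    show ?case by (simp add: q_def)
  next
    case (Suc k)
    have "poly (q (Suc k)) (x * (x + \<gamma> + \<delta> + 1)) = poly (q k) (x * (x + \<gamma> + \<delta> + 1)) *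
        (of_nat k * (of_nat k + \<gamma> + \<delta> + 1) - x * (x + \<gamma> + \<delta> + 1))"
      by (simp add: q_def left_diff_distrib right_diff_distrib mult_ac)
    also have "of_nat k * (of_nat k + \<gamma> + \<delta> + 1) - x * (x + \<gamma> + \<delta> + 1) =
        (- x + of_nat k) * (x + \<gamma> + \<delta> + 1 + of_nat k)"
      by (simp add: algebra_simps)
    finally show ?case
      unfolding Suc.IH pochhammer_Suc by (simp only: mult_ac)
  qed
  then have "poly p (x * (x + \<gamma> + \<delta> + 1)) = ?S x" for x
    unfolding p_def poly_sum poly_smult c_def by (simp add: mult.assoc)
  moreover have "degree p = n"
  proof (rule antisym)
    show "degree p \<le> n"
      unfolding p_def by (intro degree_sum_le) (auto intro: order.trans[OF degree_smult_le] simp: deg_q)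
    have "c n \<noteq> 0"
      using assms unfolding c_def by (simp add: pochhammer_of_nat_eq_0_iff)
    moreover have "coeff p n = c n * coeff (q n) n"
    proof -
      have "coeff p n = (\<Sum>k\<le>n. if k = n then c n * coeff (q n) n else 0)"
        unfolding p_def coeff_sum coeff_smult
        by (intro sum.cong) (auto simp: deg_q coeff_eq_0)
      then show ?thesis by simp
    qed
    moreover have "coeff (q n) n \<noteq> 0"
    proof -
      have "q n \<noteq> 0" by (simp add: q_def)
      then have "coeff (q n) (degree (q n)) \<noteq> 0" by (simp only: leading_coeff_0_iff not_False_eq_True)
      then show ?thesis unfolding deg_q .
    qed
    ultimately show "n \<le> degree p" by (intro le_degree) simp
  qed
  ultimately show "\<exists>p. degree p = n \<and> (\<forall>x. poly p (x * (x + \<gamma> + \<delta> + 1)) = ?S x)" by blast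
next
  fix p q
  assume p: "degree p = n \<and> (\<forall>x. poly p (x * (x + \<gamma> + \<delta> + 1)) = ?S x)"
    and q: "degree q = n \<and> (\<forall>x. poly q (x * (x + \<gamma> + \<delta> + 1)) = ?S x)"
  define l where "l = [:0, \<gamma> + \<delta> + 1, 1:]"
  have "poly l x = x * (x + \<gamma> + \<delta> + 1)" for x
    by (simp add: l_def algebra_simps)
  then have "poly (pcompose (p - q) l) = poly 0"
    using p q by (auto simp: poly_pcompose)
  then have "pcompose (p - q) l = 0" by (simp only: poly_eq_poly_eq_iff)
  moreover have "degree l > 0" by (simp add: l_def)
  ultimately have "p - q = 0" using pcompose_eq_0 by blast
  then show "p = q" by simp
qed

lemmas racah_spec = theI'[OF racah_ex1, folded racah_def]

lemma racah_ex1_hyps: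
  "pochhammer (of_nat n + (- 1 / 2) + 2 + 1 :: rat) n \<noteq> 0"
  "pochhammer ((- 1 / 2) + 1 :: rat) n \<noteq> 0"
  "pochhammer (2 + (- 1) + 1 :: rat) n \<noteq> 0"
  "pochhammer (1 + 1 :: rat) n \<noteq> 0"
  by (rule less_imp_neq[symmetric], rule pochhammer_pos, simp add: add_pos_nonneg)+

lemmas racah_special = racah_spec[OF racah_ex1_hyps]

end

theory Submission
  imports Defs
begin

text \<open>
  Put \<open>\<lambda> = x (x + 1)\<close>. Since \<open>2 * binomial_poly\<close> is \<open>\<lambda>\<close> shifted by one and
  \<open>\<Psi> (f (x + 1)) = \<Psi> f + f' 0\<close>, the candidate form is \<open>p \<mapsto> \<Psi> (\<lambda>\<^sup>2 p(\<lambda>)) / \<Psi> (\<lambda>\<^sup>2)\<close>.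
  The products \<open>T\<^sub>k = (-x)\<^sub>k (x+1)\<^sub>k\<close> satisfy \<open>(2k+1) T\<^sub>k = \<Delta> ((x - k) T\<^sub>k)\<close>, whence
  \<open>\<Psi> T\<^sub>k = k!\<^sup>2 / (2k+1)\<close>; applying \<open>\<lambda> T\<^sub>k = k (k+1) T\<^sub>k - T\<^sub>k\<^sub>+\<^sub>1\<close> twice gives
  \<open>\<Psi> (\<lambda>\<^sup>2 T\<^sub>k) = 2 (k+1)!\<^sup>2 / ((2k+1) (2k+3) (2k+5))\<close>. This turns the value of the form
  at \<open>R\<^sub>n\<close> into a \<open>\<^sub>2F\<^sub>1\<close> at 1, which the Chu--Vandermonde identity evaluates to 0.
\<close>

section \<open>Linear forms on polynomials\<close>

lemma linear_form_add: "linear_form L \<Longrightarrow> L (p + q) = L p + L q"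
  and linear_form_smult: "linear_form L \<Longrightarrow> L (smult c p) = c * L p"
  by (auto simp: linear_form_iff)

lemma linear_form_0: "linear_form L \<Longrightarrow> L 0 = 0"
  using linear_form_smult[of L 0 0] by simp

lemma linear_form_diff:
  assumes "linear_form L"
  shows "L (p - q) = L p - L q"
  using linear_form_add[OF assms, of "p - q" q] by simp

lemma linear_form_sum:
  assumes "linear_form L"
  shows "L (sum f A) = (\<Sum>i\<in>A. L (f i))"
  using linear_form_add[OF assms] linear_form_0[OF assms]
  by (induction A rule: infinite_finite_induct) auto

text \<open>Subtracting the multiple of \<open>P n\<close> that cancels the leading term lowers the
  degree, so induction on the degree applies. The condition \<open>nz\<close> is separate because
  the zero polynomial also has degree 0.\<close>

lemma linear_form_cong_degree_basis:
  assumes "linear_form L" "linear_form M"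
    and deg: "\<And>n. degree (P n) = n" and nz: "P 0 \<noteq> 0"
    and eq: "\<And>n. L (P n) = M (P n)"
  shows "L = M"
proof
  fix p
  show "L p = M p"
  proof (induction "degree p" arbitrary: p rule: less_induct)
    case (less p)
    define n where "n = degree p"
    define c where "c = coeff p n / coeff (P n) n"
    define r where "r = p - smult c (P n)"
    have "P n \<noteq> 0" using nz deg[of n] by (cases "n = 0") auto
    then have lc: "coeff (P n) n \<noteq> 0"
      using deg[of n] by (metis leading_coeff_0_iff)
    have r_n: "coeff r n = 0"
      using lc by (simp add: r_def c_def)
    have "degree r \<le> n"
      unfolding r_def by (intro degree_diff_le) (auto simp: n_def deg intro: order.trans[OF degree_smult_le])
    then have "r = 0 \<or> degree r < degree p"
      using r_n by (metis le_neq_implies_less leading_coeff_0_iff n_def)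
    then have "L r = M r"
      using less linear_form_0 assms(1,2) by metis
    moreover have "p = r + smult c (P n)" by (simp add: r_def)
    ultimately show ?case
      using assms(1,2) eq[of n] by (metis linear_form_add linear_form_smult)
  qed
qed

section \<open>Bernoulli numbers under translation\<close>

lemma pcompose_power:
  fixes p q :: "'a::comm_semiring_1 poly"
  shows "pcompose (p ^ n) q = pcompose p q ^ n"
  by (induction n) (simp_all add: pcompose_mult pcompose_1)

text \<open>Compares coefficients in B e^t = t + B, where B is the exponential generating function;
  the summand t accounts for the exception at n = 1.\<close>

lemma bernoulli_binomial_sum:
  "(\<Sum>i\<le>n. of_nat (n choose i) * bernoulli i) = bernoulli n + (if n = 1 then 1 else 0)"
proof -
  define B where "B = Abs_fps (\<lambda>n. bernoulli n / fact n)"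
  have "B * fps_exp 1 = fps_X + B"
    using bernoulli_egf by (simp add: B_def algebra_simps)
  then have "fps_nth (B * fps_exp 1) n = fps_nth (fps_X + B) n" by simp
  then have eq: "(\<Sum>i\<le>n. bernoulli i / fact i * (1 / fact (n - i))) =
      (if n = 1 then 1 else 0) + bernoulli n / fact n"
    by (simp add: B_def fps_mult_nth atLeast0AtMost)
  have "(\<Sum>i\<le>n. of_nat (n choose i) * bernoulli i) =
      fact n * (\<Sum>i\<le>n. bernoulli i / fact i * (1 / fact (n - i)))"
    unfolding sum_distrib_left by (intro sum.cong) (auto simp: binomial_fact)
  then show ?thesis unfolding eq by (simp add: algebra_simps)
qed

text \<open>Both sides are linear in \<open>f\<close>. On monomials the binomial theorem reduces the
  claim to \<open>bernoulli_binomial_sum\<close>, and the derivative at 0 is the correction at n =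
  1.\<close>

lemma bernoulli_form_shift:
  assumes lin: "linear_form \<Psi>" and mono: "\<And>n. \<Psi> (monom 1 n) = bernoulli n"
  shows "\<Psi> (pcompose f [:1, 1:]) = \<Psi> f + poly (pderiv f) 0"
proof -
  have "linear_form (\<lambda>f. \<Psi> (pcompose f [:1, 1:]))"
    and "linear_form (\<lambda>f. \<Psi> f + poly (pderiv f) 0)"
    using lin by (simp_all add: linear_form_iff pcompose_add pcompose_smult pderiv_add pderiv_smult
        algebra_simps)
  moreover have "\<Psi> (pcompose (monom 1 n) [:1, 1:]) = \<Psi> (monom 1 n) + poly (pderiv (monom 1 n)) 0"
    for n
  proof -
    have "[:1, 1:] = monom 1 1 + (1 :: rat poly)"
      by (simp add: monom_altdef one_pCons)
    then have "pcompose (monom 1 n) [:1, 1:] = (monom 1 1 + 1 :: rat poly) ^ n"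
      by (simp add: monom_altdef pcompose_power pcompose_pCons)
    also have "\<dots> = (\<Sum>i\<le>n. smult (of_nat (n choose i)) (monom 1 i))"
      by (simp add: binomial_ring monom_power of_nat_poly)
    finally have "\<Psi> (pcompose (monom 1 n) [:1, 1:]) = bernoulli n + (if n = 1 then 1 else 0)"
      by (simp add: linear_form_sum[OF lin] linear_form_smult[OF lin] mono bernoulli_binomial_sum)
    moreover have "poly (pderiv (monom (1 :: rat) n)) 0 = (if n = 1 then 1 else 0)"
      by (cases n) (auto simp: pderiv_monom poly_monom power_0_left)
    ultimately show ?thesis by (simp add: mono)
  qed
  ultimately have "(\<lambda>f. \<Psi> (pcompose f [:1, 1:])) = (\<lambda>f. \<Psi> f + poly (pderiv f) 0)"
    by (intro linear_form_cong_degree_basis[where P = "monom 1"]) (auto simp: degree_monom_eq)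
  then show ?thesis by (rule fun_cong)
qed

section \<open>The products T_k as polynomials in x\<close>

definition central :: "nat \<Rightarrow> rat poly" where
  "central k = (\<Prod>j<k. [:of_nat (j * (j + 1)), - 1, - 1:])"

lemma central_0: "central 0 = 1"
  by (simp add: central_def)

lemma central_Suc: "central (Suc k) = central k * [:of_nat (k * (k + 1)), - 1, - 1:]"
  by (simp add: central_def)

text \<open>The factor j (j+1) - x (x+1) splits as (-x + j) (x + 1 + j).\<close>

lemma poly_central: "poly (central k) x = pochhammer (- x) k * pochhammer (x + 1) k"
  by (induction k) (simp_all add: central_0 central_Suc pochhammer_Suc algebra_simps)

lemma mult_central:
  "[:0, 1, 1:] * central k = smult (of_nat (k * (k + 1))) (central k) - central (Suc k)"
  by (simp add: central_Suc mult.commute)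

lemma central_difference:
  "pcompose ([:- of_nat k, 1:] * central k) [:1, 1:] - [:- of_nat k, 1:] * central k =
    smult (2 * of_nat k + 1) (central k)" (is "?l = ?r")
proof -
  have "poly ?l x = poly ?r x" for x
  proof -
    \<comment> \<open>Both facts split a product of k + 1 consecutive factors at its first and at
      its last factor.\<close>
    have 1: "(x + 1) * pochhammer (x + 2) k = pochhammer (x + 1) k * (x + 1 + of_nat k)"
      using pochhammer_rec[of "x + 1" k] pochhammer_Suc[of "x + 1" k] by (simp add: add.assoc)
    have 2: "(- 1 - x) * pochhammer (- x) k = pochhammer (- 1 - x) k * (- 1 - x + of_nat k)"
      using pochhammer_rec[of "- 1 - x" k] pochhammer_Suc[of "- 1 - x" k] by simp
    \<comment> \<open>By \<open>2\<close>, multiplying (-1-x)_k by x + 1 - k gives (x+1) (-x)_k;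
      fact \<open>1\<close> then absorbs x + 1.\<close>
    have "(x + 1 - of_nat k) * (pochhammer (- 1 - x) k * pochhammer (x + 2) k) =
        ((x + 1) * pochhammer (x + 2) k) * pochhammer (- x) k"
      using 2 by algebra
    then have "(x + 1 - of_nat k) * (pochhammer (- 1 - x) k * pochhammer (x + 2) k) =
        (x + 1 + of_nat k) * (pochhammer (- x) k * pochhammer (x + 1) k)"
      unfolding 1 by (simp only: mult_ac)
    then show ?thesis
      by (simp add: poly_pcompose poly_central algebra_simps)
  qed
  then show ?thesis by (simp add: poly_eq_poly_eq_iff[symmetric] fun_eq_iff)
qed

lemma poly_central_0: "poly (central k) 0 = (if k = 0 then 1 else 0)"
  by (simp add: poly_central pochhammer_0_left)

text \<open>Since T_k vanishes at 0 for k > 0, passing to T_(k+1) only multiplies the derivative at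
  0 by k (k+1); for T_1 it is -1.\<close>

lemma poly_pderiv_central_0:
  "poly (pderiv (central (Suc k))) 0 = - (fact k * fact (Suc k))"
proof (induction k)
  case 0
  show ?case by (simp add: central_Suc central_0 pderiv_pCons)
next
  case (Suc k)
  show ?case
    unfolding central_Suc[of "Suc k"] pderiv_mult
    by (simp add: Suc.IH poly_central_0 algebra_simps)
qed

section \<open>Values of the Bernoulli form on T_k and its multiples\<close>

context
  fixes \<Psi> :: "rat poly \<Rightarrow> rat"
  assumes lin: "linear_form \<Psi>" and mono: "\<And>n. \<Psi> (monom 1 n) = bernoulli n"
begin

lemma bernoulli_form_central: "\<Psi> (central k) = (fact k)\<^sup>2 / (2 * of_nat k + 1)"
proof -
  let ?P = "[:- of_nat k, 1:] * central k"
  have "(2 * of_nat k + 1) * \<Psi> (central k) = \<Psi> (pcompose ?P [:1, 1:] - ?P)"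
    unfolding central_difference linear_form_smult[OF lin] ..
  also have "\<dots> = poly (pderiv ?P) 0"
    by (simp only: linear_form_diff[OF lin] bernoulli_form_shift[OF lin mono] add_diff_cancel_left')
  \<comment> \<open>The derivative is T_k(0) - k T_k'(0), that is 1 for k = 0 and k (k-1)! k!
    otherwise.\<close>
  also have "\<dots> = (fact k)\<^sup>2"
    unfolding pderiv_mult
    by (cases k) (simp_all add: poly_central_0 central_0 pderiv_pCons poly_pderiv_central_0
        power2_eq_square algebra_simps)
  finally show ?thesis
    using of_nat_0_le_iff[of k, where 'a = rat] by (simp add: field_simps add_eq_0_iff2)
qed

text \<open>The two terms from \<open>mult_central\<close> combine through k (2k+3) - (k+1) (2k+1) =
  -1.\<close>

lemma bernoulli_form_mult_central:
  "\<Psi> ([:0, 1, 1:] * central k) =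
    - (fact k * fact (Suc k)) / ((2 * of_nat k + 1) * (2 * of_nat k + 3))"
proof -
  have "(2 * of_nat k + 1 :: rat) > 0" "(2 * of_nat k + 3 :: rat) > 0"
    by (simp_all add: add_nonneg_pos)
  then show ?thesis
    unfolding mult_central linear_form_diff[OF lin] linear_form_smult[OF lin] bernoulli_form_central
    by (simp add: divide_simps) (simp add: algebra_simps power2_eq_square)
qed

text \<open>The same reduction once more, now with (k+2) (2k+1) - k (2k+5) = 2.\<close>

lemma bernoulli_form_square_mult_central:
  "\<Psi> ([:0, 1, 1:]\<^sup>2 * central k) =
    2 * (fact (Suc k))\<^sup>2 / ((2 * of_nat k + 1) * (2 * of_nat k + 3) * (2 * of_nat k + 5))"
proof -
  have pos: "(2 * of_nat k + 1 :: rat) > 0" "(2 * of_nat k + 3 :: rat) > 0"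
    "(2 * of_nat k + 5 :: rat) > 0"
    by (simp_all add: add_nonneg_pos)
  have "[:0, 1, 1:]\<^sup>2 * central k = smult (of_nat (k * (k + 1))) ([:0, 1, 1:] * central k) -
      [:0, 1, 1:] * central (Suc k)"
    unfolding power2_eq_square mult.assoc
    by (subst mult_central[of k]) (simp only: right_diff_distrib mult_smult_right)
  then have "\<Psi> ([:0, 1, 1:]\<^sup>2 * central k) =
      of_nat (k * (k + 1)) * \<Psi> ([:0, 1, 1:] * central k) - \<Psi> ([:0, 1, 1:] * central (Suc k))"
    by (simp only: linear_form_diff[OF lin] linear_form_smult[OF lin])
  also have "\<dots> = 2 * (fact (Suc k))\<^sup>2 /
      ((2 * of_nat k + 1) * (2 * of_nat k + 3) * (2 * of_nat k + 5))"
    unfolding bernoulli_form_mult_central using pos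
    by (simp add: divide_simps) (simp add: algebra_simps power2_eq_square)
  finally show ?thesis .
qed

text \<open>In this form the denominators (1/2)_k (2)_k (2)_k of the Racah coefficients cancel. The
  constant 2/15 is the value at k = 0.\<close>

lemma bernoulli_form_square_mult_central_pochhammer:
  "\<Psi> ([:0, 1, 1:]\<^sup>2 * central k) =
    2 / 15 * (pochhammer (1 / 2) k * pochhammer 2 k * pochhammer 2 k / pochhammer (7 / 2) k)"
proof -
  have pos: "(2 * of_nat k + 1 :: rat) > 0" "(2 * of_nat k + 3 :: rat) > 0"
    "(2 * of_nat k + 5 :: rat) > 0"
    by (simp_all add: add_nonneg_pos)
  have two: "pochhammer 2 k = (fact (Suc k) :: rat)" for k
    by (induction k) (simp_all add: pochhammer_Suc algebra_simps)
  have "pochhammer (1 / 2 :: rat) k > 0" "pochhammer (7 / 2 :: rat) k > 0"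
    by (intro pochhammer_pos; simp)+
  moreover have "15 * pochhammer (7 / 2 :: rat) k =
      (2 * of_nat k + 1) * (2 * of_nat k + 3) * (2 * of_nat k + 5) * pochhammer (1 / 2) k"
    by (induction k) (simp_all add: pochhammer_Suc field_simps)
  ultimately show ?thesis
    unfolding bernoulli_form_square_mult_central two using pos
    by (simp add: divide_simps power2_eq_square)
qed

end

section \<open>The Racah family and its orthogonality to 1\<close>

abbreviation (input) racah_family :: "nat \<Rightarrow> rat poly" where
  "racah_family \<equiv> racah (- 1 / 2) 2 1 (- 1)"

lemma degree_racah_family: "degree (racah_family n) = n"
  using racah_special by blast

text \<open>Because \<gamma> + \<delta> = 0, the lattice x (x + \<gamma> + \<delta> + 1) is
  \<lambda>, and the Pochhammer symbols containing x form T_k.\<close>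

lemma pcompose_racah_family:
  "pcompose (racah_family n) [:0, 1, 1:] =
    (\<Sum>k\<le>n. smult (pochhammer (- of_nat n) k * pochhammer (of_nat n + 5 / 2) k /
      (pochhammer (1 / 2) k * pochhammer 2 k * pochhammer 2 k * fact k)) (central k))"
  (is "?l = ?r")
proof -
  have "poly ?l x = poly ?r x" for x
  proof -
    have "poly ?l x = poly (racah_family n) (x * (x + 1 + (- 1) + 1))"
      by (simp add: poly_pcompose algebra_simps)
    also have "\<dots> = poly ?r x"
      unfolding conjunct2[OF racah_special, rule_format] poly_sum poly_smult poly_central
      by (intro sum.cong) (simp_all add: mult.assoc add_ac)
    finally show ?thesis .
  qed
  then show ?thesis by (simp add: poly_eq_poly_eq_iff[symmetric] fun_eq_iff)
qed

lemma racah_family_0: "racah_family 0 = 1"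
proof -
  obtain c where "racah_family 0 = [:c:]"
    using degree_racah_family[of 0] degree_eq_zeroE by blast
  then show ?thesis
    using pcompose_racah_family[of 0] by (simp add: central_0 one_pCons)
qed

lemma bernoulli_form_racah_family:
  assumes "linear_form \<Psi>" "\<And>n. \<Psi> (monom 1 n) = bernoulli n" "n > 0"
  shows "\<Psi> ([:0, 1, 1:]\<^sup>2 * pcompose (racah_family n) [:0, 1, 1:]) = 0"
proof -
  have pos: "pochhammer (1 / 2 :: rat) k > 0" "pochhammer (2 :: rat) k > 0"
    "pochhammer (7 / 2 :: rat) k > 0" for k
    by (intro pochhammer_pos; simp)+
  let ?c = "\<lambda>k. pochhammer (- of_nat n) k * pochhammer (of_nat n + 5 / 2) k /
      (pochhammer (1 / 2) k * pochhammer 2 k * pochhammer 2 k * fact k) :: rat"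
  have "\<Psi> ([:0, 1, 1:]\<^sup>2 * pcompose (racah_family n) [:0, 1, 1:]) =
      (\<Sum>k\<le>n. ?c k * \<Psi> ([:0, 1, 1:]\<^sup>2 * central k))"
    unfolding pcompose_racah_family sum_distrib_left mult_smult_right
    by (simp only: linear_form_sum[OF assms(1)] linear_form_smult[OF assms(1)])
  \<comment> \<open>The sum is 2F1(-n, n + 5/2; 7/2; 1).\<close>
  also have "\<dots> = 2 / 15 * (\<Sum>k = 0..n. pochhammer (of_nat n + 5 / 2) k * pochhammer (- of_nat n) k /
      (of_nat (fact k) * pochhammer (7 / 2) k))"
    unfolding bernoulli_form_square_mult_central_pochhammer[OF assms(1,2)] sum_distrib_left
      atLeast0AtMost
    using pos by (intro sum.cong refl) (simp add: divide_simps less_imp_neq[symmetric])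
  also have "\<dots> = 2 / 15 * (pochhammer (7 / 2 - (of_nat n + 5 / 2)) n / pochhammer (7 / 2) n)"
    by (subst Vandermonde_pochhammer) (auto simp: add_pos_nonneg add_eq_0_iff2 field_simps)
  \<comment> \<open>The base is 1 - n = -(n - 1), so the factor with index n - 1 vanishes; n > 0
    puts that index in range.\<close>
  also have "pochhammer (7 / 2 - (of_nat n + 5 / 2)) n = (0 :: rat)"
    unfolding pochhammer_eq_0_iff using assms(3)
    by (intro exI[of _ "n - 1"]) (simp add: of_nat_diff)
  finally show ?thesis by simp
qed

theorem theorem2p4:
  fixes \<Psi> :: "rat poly \<Rightarrow> rat" and Rplus :: "nat \<Rightarrow> rat" and R :: "nat \<Rightarrow> rat poly"
  assumes "linear_form \<Psi>" and "\<And>n. \<Psi> (monom 1 n) = bernoulli n"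
    and "\<And>n. Rplus n = \<Psi> (binomial_poly ^ n)"
    and "\<And>n. R n = racah (- 1 / 2) 2 1 (- 1) n"
  shows "(\<exists>!\<Lambda>. linear_form \<Lambda> \<and> \<Lambda> 1 = 1 \<and> (\<forall>n>0. \<Lambda> (R n) = 0)) \<and>
    (\<forall>\<Lambda>. linear_form \<Lambda> \<and> \<Lambda> 1 = 1 \<and> (\<forall>n>0. \<Lambda> (R n) = 0) \<longrightarrow>
      (\<forall>n. \<Lambda> (monom 1 n) = 2 ^ n * Rplus (n + 2) / Rplus 2))"
proof -
  let ?l = "[:0, 1, 1:] :: rat poly"
  \<comment> \<open>The factor 15/2 is 1 / \<Psi>(\<lambda>^2), which makes
    \<open>M 1 = 1\<close>.\<close>
  define M where "M p = 15 / 2 * \<Psi> (?l\<^sup>2 * pcompose p ?l)" for p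
  have lin_M: "linear_form M"
    using assms(1) by (simp add: M_def linear_form_iff pcompose_add pcompose_smult algebra_simps)
  have M_1: "M 1 = 1"
    using bernoulli_form_square_mult_central[OF assms(1,2), of 0]
    by (simp add: M_def central_0 pcompose_1)
  have M_R: "\<forall>n>0. M (R n) = 0"
    using bernoulli_form_racah_family[OF assms(1,2)] by (simp add: M_def assms(4))
  have R_0: "R 0 = 1"
    unfolding assms(4) by (rule racah_family_0)
  \<comment> \<open>The \<open>R n\<close> have degree n and form a basis, on which the conditions
    prescribe every value.\<close>
  have unique: "L = M" if "linear_form L" "L 1 = 1" "\<forall>n>0. L (R n) = 0" for L
  proof (rule linear_form_cong_degree_basis[where P = R])
    show "L (R n) = M (R n)" for n
      using that M_1 M_R R_0 by (cases "n = 0") auto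
    show "degree (R n) = n" for n
      unfolding assms(4) by (rule degree_racah_family)
  qed (use that lin_M R_0 in simp_all)
  have shift: "\<Psi> (binomial_poly ^ (n + 2)) = \<Psi> (?l ^ (n + 2)) / 2 ^ (n + 2)" for n
  proof -
    have "binomial_poly = smult (1 / 2) (pcompose ?l [:1, 1:])"
      by (simp add: binomial_poly_def pcompose_pCons)
    then have "binomial_poly ^ (n + 2) = smult ((1 / 2) ^ (n + 2)) (pcompose (?l ^ (n + 2)) [:1, 1:])"
      by (simp only: pcompose_power smult_power[symmetric])
    \<comment> \<open>Zero is a root of \<lambda>, hence a multiple root of any power with exponent
      at least 2, and the shift adds no correction.\<close>
    moreover have "poly (pderiv (?l ^ (n + 2))) 0 = 0"
      by (simp add: pderiv_pCons)
    ultimately show ?thesis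
      by (simp only: linear_form_smult[OF assms(1)] bernoulli_form_shift[OF assms(1,2)])
        (simp add: power_one_over)
  qed
  \<comment> \<open>The weight \<lambda>^2 raises the exponent by 2, whence the index n + 2.\<close>
  have M_monom: "M (monom 1 n) = 15 / 2 * \<Psi> (?l ^ (n + 2))" for n
    unfolding power_add
    by (simp add: M_def monom_altdef pcompose_power pcompose_pCons mult.commute[of "?l\<^sup>2"])
  have Rplus: "Rplus (n + 2) = \<Psi> (?l ^ (n + 2)) / 2 ^ (n + 2)" for n
    unfolding assms(3) by (rule shift)
  have "\<Psi> (?l ^ 2) = 2 / 15"
    using M_1 by (simp add: M_def pcompose_1)
  then have "Rplus (0 + 2) = 2 / 15 / 2 ^ 2"
    unfolding Rplus unfolding add_0 by (rule arg_cong)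
  then have Rplus_2: "Rplus 2 = 1 / 30"
    unfolding add_0 by simp
  have "M (monom 1 n) = 2 ^ n * Rplus (n + 2) / Rplus 2" for n
  proof -
    \<comment> \<open>The powers of 2 leave 1/4, and 30 / 4 = 15 / 2.\<close>
    have "15 / 2 * c = 2 ^ n * (c / 2 ^ (n + 2)) / (1 / 30)" for c :: rat
      by (simp add: power_add)
    then show ?thesis
      unfolding M_monom Rplus Rplus_2 .
  qed
  then show ?thesis
    using lin_M M_1 M_R by (blast dest: unique intro: ex1I[of _ M])
qed

end
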